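(* Let $G$ be a spider forest in which no spider (component) has a 1-leg, i.e. every leg of every component of $G$ has length at least $2$. Then $G$ is $k$-shifted antimagic for every integer $k \geq 0$.
   Context: All graphs are finite, simple, and undirected. For integers $a \le b$, $[a,b]=\{x\in\mathbb{Z}: a\le x\le b\}$. A spider is a tree with exactly one vertex of degree greater than two; that vertex is called its center. A leg of a spider is a path connecting its center to a leaf (degree-one vertex); the length of a leg is the number of edges on that path. A 1-leg is a leg of length one (a pendant edge incident to the center). A spider forest is a graph (possibly disconnected) each of whose connected components is a spider. Let $G=(V,E)$ be a graph with $m$ edges and let $k$ be an integer (possibly negative). For a bijection $f:E\to[k+1,k+m]$, the vertex-sum of $v\in V$ is $\phi_f(v)=\sum_{e\ni v} f(e)$, the sum of the labels of the edges incident to $v$. The bijection $f$ is a $k$-shifted antimagic labeling if $\phi_f(u)\neq\phi_f(v)$ for all distinct vertices $u,v\in V$. The graph $G$ is $k$-shifted antimagic if it admits a $k$-shifted antimagic labeling. *)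

theory Defs
  imports Main
begin

text \<open>A graph is given by a vertex set \<open>V\<close> and an edge set \<open>E\<close> whose members are
  two-element subsets of \<open>V\<close>.\<close>

definition finite_simple_graph :: "'a set \<Rightarrow> 'a set set \<Rightarrow> bool" where
  "finite_simple_graph V E \<longleftrightarrow> finite V \<and> (\<forall>e\<in>E. e \<subseteq> V \<and> card e = 2)"

definition incident_edges :: "'a set set \<Rightarrow> 'a \<Rightarrow> 'a set set" where
  "incident_edges E v = {e \<in> E. v \<in> e}"

definition vertex_degree :: "'a set set \<Rightarrow> 'a \<Rightarrow> nat" where
  "vertex_degree E v = card (incident_edges E v)"

definition is_path :: "'a set \<Rightarrow> 'a set set \<Rightarrow> 'a list \<Rightarrow> bool" where
  "is_path V E p \<longleftrightarrow>
     p \<noteq> [] \<and> set p \<subseteq> V \<and> distinct p \<and> successively (\<lambda>u v. {u, v} \<in> E) p"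

text \<open>The number of edges; a path is a nonempty list, so the subtraction never truncates.\<close>

definition path_edge_length :: "'a list \<Rightarrow> nat" where
  "path_edge_length p = length p - 1"

definition joined_by_path :: "'a set \<Rightarrow> 'a set set \<Rightarrow> 'a \<Rightarrow> 'a \<Rightarrow> bool" where
  "joined_by_path V E u v \<longleftrightarrow> (\<exists>p. is_path V E p \<and> hd p = u \<and> last p = v)"

definition is_cycle :: "'a set \<Rightarrow> 'a set set \<Rightarrow> 'a list \<Rightarrow> bool" where
  "is_cycle V E p \<longleftrightarrow> is_path V E p \<and> 3 \<le> length p \<and> {last p, hd p} \<in> E"

definition connected_graph :: "'a set \<Rightarrow> 'a set set \<Rightarrow> bool" where
  "connected_graph V E \<longleftrightarrow> V \<noteq> {} \<and> (\<forall>u\<in>V. \<forall>v\<in>V. joined_by_path V E u v)"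

definition is_tree :: "'a set \<Rightarrow> 'a set set \<Rightarrow> bool" where
  "is_tree V E \<longleftrightarrow>
     finite_simple_graph V E \<and> connected_graph V E \<and> (\<nexists>p. is_cycle V E p)"

text \<open>Vertex sets of the connected components; the component itself is the induced subgraph.\<close>

definition component_vertex_sets :: "'a set \<Rightarrow> 'a set set \<Rightarrow> 'a set set" where
  "component_vertex_sets V E = {{u \<in> V. joined_by_path V E v u} | v. v \<in> V}"

definition induced_edges :: "'a set set \<Rightarrow> 'a set \<Rightarrow> 'a set set" where
  "induced_edges E C = {e \<in> E. e \<subseteq> C}"

definition is_spider_center :: "'a set \<Rightarrow> 'a set set \<Rightarrow> 'a \<Rightarrow> bool" where
  "is_spider_center V E c \<longleftrightarrow> c \<in> V \<and> 2 < vertex_degree E c"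

definition is_spider :: "'a set \<Rightarrow> 'a set set \<Rightarrow> bool" where
  "is_spider V E \<longleftrightarrow> is_tree V E \<and> (\<exists>!c. is_spider_center V E c)"

definition is_leg :: "'a set \<Rightarrow> 'a set set \<Rightarrow> 'a list \<Rightarrow> bool" where
  "is_leg V E p \<longleftrightarrow>
     is_path V E p \<and> is_spider_center V E (hd p) \<and> vertex_degree E (last p) = 1"

definition is_spider_forest :: "'a set \<Rightarrow> 'a set set \<Rightarrow> bool" where
  "is_spider_forest V E \<longleftrightarrow>
     finite_simple_graph V E \<and>
     (\<forall>C \<in> component_vertex_sets V E. is_spider C (induced_edges E C))"

definition vertex_sum :: "'a set set \<Rightarrow> ('a set \<Rightarrow> int) \<Rightarrow> 'a \<Rightarrow> int" where
  "vertex_sum E f v = (\<Sum>e\<in>incident_edges E v. f e)"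

definition shifted_antimagic_labeling ::
    "int \<Rightarrow> 'a set \<Rightarrow> 'a set set \<Rightarrow> ('a set \<Rightarrow> int) \<Rightarrow> bool" where
  "shifted_antimagic_labeling k V E f \<longleftrightarrow>
     bij_betw f E {k + 1..k + int (card E)} \<and>
     (\<forall>u\<in>V. \<forall>v\<in>V. u \<noteq> v \<longrightarrow> vertex_sum E f u \<noteq> vertex_sum E f v)"

definition shifted_antimagic :: "int \<Rightarrow> 'a set \<Rightarrow> 'a set set \<Rightarrow> bool" where
  "shifted_antimagic k V E \<longleftrightarrow> (\<exists>f. shifted_antimagic_labeling k V E f)"

end

theory Submission imports Defs begin

text \<open>A leg of length \<open>2q\<close> or \<open>2q + 1\<close> uses \<open>q\<close> small labels and \<open>q\<close> big labels, which alternate along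
  the leg with a small one at the leaf; a leg of odd length has one further label, larger than all
  these, at the center. List the legs in some order and hand out the small, the big and the further
  labels increasingly along the list. The sums of a small and a big label then increase along the
  list, so all vertices other than the centers have distinct sums, whatever the order is.

  The order takes care of the centers. Reserve one leg of every spider; list the reserved
  legs first, then the other legs of odd length, then the other legs of even length. Two of the edges
  at a center then have labels beyond the big labels of all legs of odd length, which makes every
  center sum exceed all other sums. The center sum is a known contribution \<open>w\<close> of the other legs plus
  the label of the reserved leg. Ordering the reserved legs of odd length by \<open>w\<close> makes the center
  sums of their spiders distinct, and these sums do not depend on how the reserved legs of even
  length, again ordered by \<open>w\<close>, are merged into the list. Merging greedily, where a leg of odd length
  is put in whenever its center sum is about to be reached, keeps the two kinds of center sums
  apart.\<close>

section \<open>Orderings of the legs\<close>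

text \<open>For \<open>f\<close> counting the small labels of each leg, this is the offset at which
  the block of \<open>v\<close> starts. For \<open>v\<close> outside the list it is the total
  weight.\<close>

fun weight_before :: "('a \<Rightarrow> nat) \<Rightarrow> 'a list \<Rightarrow> 'a \<Rightarrow> nat" where
  "weight_before f [] v = 0"
| "weight_before f (x # xs) v = (if v = x then 0 else f x + weight_before f xs v)"

lemma weight_before_append:
  "weight_before f (xs @ ys) v =
     (if v \<in> set xs then weight_before f xs v else sum_list (map f xs) + weight_before f ys v)"
  by (induction xs) auto

lemma weight_before_le:
  "v \<in> set xs \<Longrightarrow> weight_before f xs v + f v \<le> sum_list (map f xs)"
  by (induction xs) auto

text \<open>Which alternative holds depends only on which of \<open>u\<close> and \<open>v\<close>
  comes first. Hence \<open>f\<close> is quantified inside: the offsets for different weights are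
  ordered the same way.\<close>

lemma weight_before_cases:
  assumes "u \<in> set xs" "v \<in> set xs" "u \<noteq> v"
  shows "(\<forall>f. weight_before f xs u + f u \<le> weight_before f xs v) \<or>
    (\<forall>f. weight_before f xs v + f v \<le> weight_before f xs u)"
  using assms by (induction xs) auto

text \<open>If \<open>s o \<le> w e + x\<close> holds for the first elements \<open>o\<close> and \<open>e\<close>, then putting \<open>o\<close> first pushes all values of
  the \<open>es\<close> beyond \<open>s o\<close>; otherwise putting \<open>e\<close> first gives it a value below all of \<open>s\<close>.\<close>

lemma merge_avoiding:
  fixes w s :: "'a \<Rightarrow> int" and x :: int
  assumes "sorted (map w es)" "sorted_wrt (\<lambda>a b. s a < s b) os"
    and "distinct es" "distinct os" "set es \<inter> set os = {}"
    and "\<And>v. v \<in> set es \<union> set os \<Longrightarrow> 0 < q v" "\<And>v. v \<in> set es \<Longrightarrow> p v = 0"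
  shows "\<exists>xs. distinct xs \<and> set xs = set es \<union> set os \<and>
     (\<forall>v\<in>set es. w v + x + int (weight_before q xs v) \<notin> s ` set os) \<and>
     inj_on (\<lambda>v. w v + x + int (weight_before q xs v)) (set es) \<and>
     (\<forall>v\<in>set os. weight_before p xs v = weight_before p os v)"
  using assms
\<comment> \<open>\<open>x\<close> must vary: it absorbs the \<open>q\<close>-weight of the elements
  already placed in front.\<close>
proof (induction "length es + length os" arbitrary: es os x)
  case 0
  then show ?case by auto
next
  case (Suc N)
  show ?case
  proof (cases es)
    case Nil
    then show ?thesis using Suc.prems by (intro exI[of _ os]) auto
  next
    case es: (Cons e es')
    show ?thesis
    proof (cases "os \<noteq> [] \<and> s (hd os) \<le> w e + x")
      case True
      then obtain a os' where os: "os = a # os'" and a: "s a \<le> w e + x"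
        by (cases os) auto
      obtain xs where xs: "distinct xs" "set xs = set es \<union> set os'"
        "\<forall>v\<in>set es. w v + (x + int (q a)) + int (weight_before q xs v) \<notin> s ` set os'"
        "inj_on (\<lambda>v. w v + (x + int (q a)) + int (weight_before q xs v)) (set es)"
        "\<forall>v\<in>set os'. weight_before p xs v = weight_before p os' v"
        using Suc.hyps(1)[of es os' "x + int (q a)"] Suc.hyps(2) Suc.prems by (auto simp: os)
      have eq: "w v + x + int (weight_before q (a # xs) v) =
          w v + (x + int (q a)) + int (weight_before q xs v)" if "v \<in> set es" for v
        using that Suc.prems(5) os by auto
      have "0 < q a" using Suc.prems(6) os by auto
      moreover have "w e \<le> w v" if "v \<in> set es" for v
        using that Suc.prems(1) by (auto simp: es)
      ultimately have ne: "w v + (x + int (q a)) + int (weight_before q xs v) \<noteq> s a"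
        if "v \<in> set es" for v
        using that a by (smt (verit) of_nat_0_le_iff of_nat_0_less_iff)
      have "inj_on (\<lambda>v. w v + x + int (weight_before q (a # xs) v)) (set es)"
        using xs(4) by (subst inj_on_cong[OF eq])
      moreover have "\<forall>v\<in>set es. w v + x + int (weight_before q (a # xs) v) \<notin> s ` set os"
      proof
        fix v assume v: "v \<in> set es"
        show "w v + x + int (weight_before q (a # xs) v) \<notin> s ` set os"
          unfolding eq[OF v] using xs(3) ne[OF v] v by (auto simp: os)
      qed
      moreover have "distinct (a # xs)" "set (a # xs) = set es \<union> set os"
        using xs(1,2) Suc.prems(4,5) by (auto simp: os)
      moreover have "\<forall>v\<in>set os. weight_before p (a # xs) v = weight_before p os v"
        using xs(5) by (simp add: os)
      ultimately show ?thesis by blast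
    next
      case False
      \<comment> \<open>Strict sortedness makes the head of \<open>os\<close> carry the least value
        of \<open>s\<close>.\<close>
      have lt: "w e + x < s b" if "b \<in> set os" for b
        using False Suc.prems(2) that by (cases os) fastforce+
      obtain xs where xs: "distinct xs" "set xs = set es' \<union> set os"
        "\<forall>v\<in>set es'. w v + (x + int (q e)) + int (weight_before q xs v) \<notin> s ` set os"
        "inj_on (\<lambda>v. w v + (x + int (q e)) + int (weight_before q xs v)) (set es')"
        "\<forall>v\<in>set os. weight_before p xs v = weight_before p os v"
        using Suc.hyps(1)[of es' os "x + int (q e)"] Suc.hyps(2) Suc.prems by (auto simp: es)
      have eq: "w v + x + int (weight_before q (e # xs) v) =
          w v + (x + int (q e)) + int (weight_before q xs v)" if "v \<in> set es'" for v
        using that Suc.prems(3) es by auto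
      have "0 < q e" using Suc.prems(6) es by auto
      moreover have "w e \<le> w v" if "v \<in> set es'" for v
        using that Suc.prems(1) by (auto simp: es)
      ultimately have ne: "w e + x < w v + (x + int (q e)) + int (weight_before q xs v)"
        if "v \<in> set es'" for v
        using that by (smt (verit) of_nat_0_le_iff of_nat_0_less_iff)
      have e0: "weight_before q (e # xs) e = 0" by simp
      have "inj_on (\<lambda>v. w v + x + int (weight_before q (e # xs) v)) (set es)"
        unfolding es list.set
      proof (intro inj_on_insert[THEN iffD2] conjI)
        show "inj_on (\<lambda>v. w v + x + int (weight_before q (e # xs) v)) (set es')"
          using xs(4) by (subst inj_on_cong[OF eq])
        show "w e + x + int (weight_before q (e # xs) e)
            \<notin> (\<lambda>v. w v + x + int (weight_before q (e # xs) v)) ` (set es' - {e})"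
        proof
          assume "w e + x + int (weight_before q (e # xs) e)
            \<in> (\<lambda>v. w v + x + int (weight_before q (e # xs) v)) ` (set es' - {e})"
          then show False
          proof (rule imageE)
            fix v
            assume v: "w e + x + int (weight_before q (e # xs) e) =
                w v + x + int (weight_before q (e # xs) v)" "v \<in> set es' - {e}"
            then have "w e + x = w v + (x + int (q e)) + int (weight_before q xs v)"
              using eq[of v] unfolding e0 by simp
            then show False using ne[of v] v(2) by simp
          qed
        qed
      qed
      moreover have "\<forall>v\<in>set es. w v + x + int (weight_before q (e # xs) v) \<notin> s ` set os"
      proof
        fix v assume "v \<in> set es"
        then consider "v = e" | "v \<in> set es'" using es by auto
        then show "w v + x + int (weight_before q (e # xs) v) \<notin> s ` set os"
        proof cases
          case 1
          have "w e + x \<noteq> s b" if "b \<in> set os" for b using lt[OF that] by simp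
          then show ?thesis unfolding 1 e0 by auto
        next
          case 2 then show ?thesis unfolding eq[OF 2] using xs(3) by blast
        qed
      qed
      \<comment> \<open>Since \<open>p e = 0\<close>, inserting \<open>e\<close> leaves the
        \<open>p\<close>-offsets of \<open>os\<close> unchanged.\<close>
      moreover have "\<forall>v\<in>set os. weight_before p (e # xs) v = weight_before p os v"
      proof
        fix v assume "v \<in> set os"
        moreover have "p e = 0" using Suc.prems(7) es by simp
        moreover have "v \<noteq> e" using \<open>v \<in> set os\<close> Suc.prems(5) es by auto
        ultimately show "weight_before p (e # xs) v = weight_before p os v" using xs(5) by simp
      qed
      moreover have "distinct (e # xs)" "set (e # xs) = set es \<union> set os"
        using xs(1,2) Suc.prems(3,5) by (auto simp: es)
      ultimately show ?thesis by blast
    qed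
  qed
qed


section \<open>The labels given by an ordering\<close>

text \<open>Elements of \<open>xs\<close> stand for legs and \<open>n\<close> for their lengths; no
  graph is involved, so that labels and sums can be compared by arithmetic alone.\<close>

locale leg_order =
  fixes k :: int and n :: "'a \<Rightarrow> nat" and xs :: "'a list"
  assumes k_nonneg: "0 \<le> k" and distinct: "distinct xs"
    and long: "\<And>v. v \<in> set xs \<Longrightarrow> 2 \<le> n v"
begin

definition half :: "'a \<Rightarrow> nat" where "half v = n v div 2"
definition parity :: "'a \<Rightarrow> nat" where "parity v = n v mod 2"
abbreviation block :: "'a \<Rightarrow> int" where "block v \<equiv> int (weight_before half xs v)"
abbreviation odds :: "'a \<Rightarrow> int" where "odds v \<equiv> int (weight_before parity xs v)"

text \<open>Small labels fill \<open>[k + 1, k + M]\<close>, big ones fill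
  \<open>[k + M + 1, k + 2 * M]\<close>, and the \<open>N_odd\<close> labels at the inner ends of
  odd legs lie above.\<close>

definition M :: int where "M = int (sum_list (map half xs))"
definition N_odd :: int where "N_odd = int (sum_list (map parity xs))"

text \<open>The edges of leg \<open>v\<close> are numbered \<open>0, \<dots>, n v - 1\<close> from the center outwards, and the vertex \<open>j\<close> is
  the outer end of the edge \<open>j\<close>. So \<open>j < parity v\<close> singles out the edge at the center of a leg of odd
  length.\<close>

definition label :: "'a \<Rightarrow> nat \<Rightarrow> int" where
  "label v j =
    (if j < parity v then k + 2 * M + odds v + 1
     else if even (j - parity v) then k + M + block v + int ((j - parity v) div 2) + 1
     else k + block v + int ((j - parity v) div 2) + 1)"

definition leg_sum :: "'a \<Rightarrow> nat \<Rightarrow> int" where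
  "leg_sum v j = label v j + (if Suc j < n v then label v (Suc j) else 0)"

lemma length_eq: "n v = parity v + 2 * half v"
  by (simp add: half_def parity_def)

lemma parity_cases: "parity v = 0 \<and> even (n v) \<or> parity v = 1 \<and> odd (n v)"
  by (simp add: parity_def) presburger

lemma half_pos: "v \<in> set xs \<Longrightarrow> 0 < half v"
  using long[of v] by (simp add: half_def)

lemma block_le: "v \<in> set xs \<Longrightarrow> block v + int (half v) \<le> M"
  unfolding M_def using weight_before_le[of v xs half] by linarith

lemma odds_le: "v \<in> set xs \<Longrightarrow> odds v + int (parity v) \<le> N_odd"
  unfolding N_odd_def using weight_before_le[of v xs parity] by linarith

lemma blocks_separate:
  assumes "u \<in> set xs" "v \<in> set xs" "u \<noteq> v"
  obtains "block u + int (half u) \<le> block v" "odds u + int (parity u) \<le> odds v"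
  | "block v + int (half v) \<le> block u" "odds v + int (parity v) \<le> odds u"
  using weight_before_cases[OF assms] of_nat_add of_nat_le_iff by metis

text \<open>The index \<open>i\<close> within the block replaces parity and division, which leaves
  comparisons of labels to linear arithmetic.\<close>

lemma label_cases:
  assumes "v \<in> set xs" "j < n v"
  obtains (top) "parity v = 1" "j = 0" "label v j = k + 2 * M + odds v + 1"
  | (big) i where "i < half v" "j = parity v + 2 * i" "label v j = k + M + block v + int i + 1"
  | (small) i where "i < half v" "j = parity v + 2 * i + 1" "label v j = k + block v + int i + 1"
proof (cases "j < parity v")
  case True
  then have "parity v = 1" using parity_cases[of v] by auto
  moreover have "j = 0" using True \<open>parity v = 1\<close> by simp
  moreover have "label v j = k + 2 * M + odds v + 1" using True by (simp add: label_def)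
  ultimately show ?thesis by (rule top)
next
  case False
  note nv = length_eq[of v]
  show ?thesis
  proof (cases "even (j - parity v)")
    case True
    then obtain i where "j - parity v = 2 * i" by blast
    then show ?thesis using big[of i] False nv assms by (auto simp: label_def)
  next
    case odd: False
    then obtain i where "j - parity v = 2 * i + 1" using oddE by blast
    then show ?thesis using small[of i] False nv assms by (auto simp: label_def)
  qed
qed

text \<open>The three kinds of labels occupy disjoint ranges, and within one kind different legs use
  disjoint intervals.\<close>

lemma label_inj:
  assumes "u \<in> set xs" "i < n u" "v \<in> set xs" "j < n v" "label u i = label v j"
  shows "u = v \<and> i = j"
proof -
  have bu: "block u + int (half u) \<le> M" and bv: "block v + int (half v) \<le> M"
    using assms block_le by auto
  have "u = v"
  proof (rule ccontr)
    assume "u \<noteq> v"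
    with assms(1,3) show False
    proof (cases rule: blocks_separate)
      case 1
      then show False using assms bu bv
        by (cases rule: label_cases[OF assms(1,2)]; cases rule: label_cases[OF assms(3,4)]) linarith+
    next
      case 2
      then show False using assms bu bv
        by (cases rule: label_cases[OF assms(1,2)]; cases rule: label_cases[OF assms(3,4)]) linarith+
    qed
  qed
  moreover have "i = j"
    using assms(5) bu bv \<open>u = v\<close>
    by (cases rule: label_cases[OF assms(1,2)]; cases rule: label_cases[OF assms(3,4)]) auto
  ultimately show ?thesis by simp
qed

lemma label_range:
  assumes "v \<in> set xs" "j < n v"
  shows "label v j \<in> {k + 1..k + int (\<Sum>u\<in>set xs. n u)}"
proof -
  \<comment> \<open>The number of edges is \<open>N_odd + 2 * M\<close>, the upper end of the third
    range relative to \<open>k\<close>.\<close>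
  have "int (\<Sum>u\<in>set xs. n u) = int (\<Sum>u\<in>set xs. parity u + 2 * half u)"
    using length_eq by simp
  also have "\<dots> = N_odd + 2 * M"
    unfolding N_odd_def M_def sum_list_distinct_conv_sum_set[OF distinct] sum.distrib
      sum_distrib_left[symmetric] by simp
  finally show ?thesis
    using block_le[OF assms(1)] odds_le[OF assms(1)]
    by (cases rule: label_cases[OF assms]) auto
qed

text \<open>A step outwards replaces a label by the next one of its kind, so the inner sums of a leg
  are consecutive integers, counted by \<open>t\<close>.\<close>

lemma leg_sum_cases:
  assumes "v \<in> set xs" "j < n v"
  obtains (leaf) "Suc j = n v" "leg_sum v j = k + block v + int (half v)"
  | (inner) t where "j = parity v + t" "Suc t < 2 * half v"
      "leg_sum v j = 2 * k + M + 2 * block v + int t + 2"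
  | (top) "parity v = 1" "j = 0" "leg_sum v j = 2 * k + 3 * M + odds v + block v + 2"
proof -
  note nv = length_eq[of v]
  have h: "0 < half v" using half_pos[OF assms(1)] .
  show ?thesis
    using assms
  proof (cases rule: label_cases)
    case top': top
    have "Suc j < n v" using top' h nv assms by linarith
    moreover have "label v (Suc j) = k + M + block v + 1" using top' by (simp add: label_def)
    ultimately show ?thesis using top' by (intro top) (auto simp: leg_sum_def)
  next
    case (big i)
    have "Suc j < n v" using big nv by linarith
    moreover have "label v (Suc j) = k + block v + int i + 1" using big by (simp add: label_def)
    ultimately show ?thesis using big by (intro inner[of "2 * i"]) (auto simp: leg_sum_def)
  next
    case (small i)
    show ?thesis
    proof (cases "Suc j < n v")
      case True
      moreover have "label v (Suc j) = k + M + block v + int (Suc i) + 1"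
        using small by (simp add: label_def)
      moreover have "Suc i < half v" using True small nv by linarith
      ultimately show ?thesis using small by (intro inner[of "2 * i + 1"]) (auto simp: leg_sum_def)
    next
      case False
      then have "Suc j = n v" "half v = Suc i" using small assms nv by linarith+
      then show ?thesis using small by (intro leaf) (auto simp: leg_sum_def)
    qed
  qed
qed

text \<open>Leaf sums are at most \<open>k + M\<close>, inner sums lie between
  \<open>2 * k + M + 2\<close> and \<open>2 * k + 3 * M\<close>, and top sums are larger;
  \<open>k >= 0\<close> separates the first two ranges. Within a range the sums follow the order of
  the legs.\<close>

lemma leg_sum_inj:
  assumes "u \<in> set xs" "i < n u" "v \<in> set xs" "j < n v" "leg_sum u i = leg_sum v j"
  shows "u = v \<and> i = j"
proof -
  have bu: "block u + int (half u) \<le> M" and bv: "block v + int (half v) \<le> M"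
    using assms block_le by auto
  have hu: "0 < int (half u)" and hv: "0 < int (half v)"
    using half_pos assms by auto
  have "u = v"
  proof (rule ccontr)
    assume "u \<noteq> v"
    with assms(1,3) show False
    proof (cases rule: blocks_separate)
      case 1
      then show False using assms bu bv hu hv k_nonneg
        by (cases rule: leg_sum_cases[OF assms(1,2)]; cases rule: leg_sum_cases[OF assms(3,4)]) linarith+
    next
      case 2
      then show False using assms bu bv hu hv k_nonneg
        by (cases rule: leg_sum_cases[OF assms(1,2)]; cases rule: leg_sum_cases[OF assms(3,4)]) linarith+
    qed
  qed
  moreover have "i = j"
    using assms(5) bu bv \<open>u = v\<close> hu k_nonneg
    by (cases rule: leg_sum_cases[OF assms(1,2)]; cases rule: leg_sum_cases[OF assms(3,4)]) auto
  ultimately show ?thesis by simp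
qed

text \<open>With \<open>B\<close> as in the proof, every first label exceeds \<open>k + M\<close>,
  and that of a nonreserved leg exceeds \<open>k + M + B\<close>. So the center sum is at least
  \<open>3 * k + 3 * M + 2 * B + 3\<close>, whereas no leg sum exceeds
  \<open>2 * k + 3 * M + 2 * B\<close>.\<close>

lemma leg_sum_less_center_sum:
  assumes xs: "xs = rs @ no @ ne" and even: "\<And>v. v \<in> set ne \<Longrightarrow> even (n v)"
    and odd: "\<And>v. v \<in> set no \<Longrightarrow> odd (n v)"
    and L: "L \<subseteq> set xs" "L \<inter> set rs \<noteq> {}" "2 \<le> card (L - set rs)"
    and u: "u \<in> set xs" "i < n u"
  shows "leg_sum u i < (\<Sum>v\<in>L. label v 0)"
proof -
  \<comment> \<open>\<open>B\<close> counts the big labels on \<open>rs\<close> and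
    \<open>no\<close>, which include all legs of odd length.\<close>
  define B where "B = int (sum_list (map half (rs @ no)))"
  have B0: "0 \<le> B" unfolding B_def by simp
  have BM: "B \<le> M" unfolding B_def M_def unfolding xs by simp
  have block_odd: "block v + int (half v) \<le> B" if "v \<in> set xs" "odd (n v)" for v
  proof -
    have "v \<in> set (rs @ no)" using that xs even by auto
    then show ?thesis
      unfolding B_def using weight_before_le[of v "rs @ no" half]
        weight_before_append[of half "rs @ no" ne v] by (simp add: xs)
  qed
  \<comment> \<open>No leg has length one, so an odd leg carries at least one big label for its
    single further label.\<close>
  have NB: "N_odd \<le> B"
  proof -
    have "parity v = 0" if "v \<in> set ne" for v using even[OF that] parity_cases[of v] by auto
    then have "sum_list (map parity ne) = 0" by (simp cong: map_cong)
    moreover have "sum_list (map parity (rs @ no)) \<le> sum_list (map half (rs @ no))"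
    proof (rule sum_list_mono)
      fix v assume "v \<in> set (rs @ no)"
      then have "0 < half v" using half_pos xs by auto
      then show "parity v \<le> half v" using parity_cases[of v] by auto
    qed
    ultimately show ?thesis unfolding N_odd_def B_def unfolding xs map_append sum_list_append by linarith
  qed
  have low: "k + M + 1 \<le> label v 0" if "v \<in> set xs" for v
    unfolding label_def using block_le[OF that] half_pos[OF that] parity_cases[of v] by auto
  \<comment> \<open>An odd leg starts above all big labels; an even leg in \<open>ne\<close> starts
    after the big labels of \<open>rs\<close> and \<open>no\<close>.\<close>
  have high: "k + M + B + 1 \<le> label v 0" if v: "v \<in> set xs" "v \<notin> set rs" for v
  proof (cases "odd (n v)")
    case True
    then show ?thesis using BM parity_cases[of v] by (auto simp: label_def)
  next
    case False
    then have "v \<notin> set (rs @ no)" using v odd by auto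
    then have "B \<le> block v"
      unfolding B_def using weight_before_append[of half "rs @ no" ne v] by (simp add: xs)
    then show ?thesis using False parity_cases[of v] by (auto simp: label_def)
  qed
  obtain r where r: "r \<in> L" "r \<in> set rs" using L(2) by auto
  obtain D where "D \<subseteq> L - set rs" "card D = 2"
    using obtain_subset_with_card_n[OF L(3)] by metis
  then obtain a b where ab: "a \<in> L - set rs" "b \<in> L - set rs" "a \<noteq> b"
    by (auto simp: card_2_iff)
  have "label r 0 + label a 0 + label b 0 = (\<Sum>v\<in>{r, a, b}. label v 0)"
  proof -
    have "r \<noteq> a" "r \<noteq> b" using r ab by auto
    then show ?thesis using ab(3) by simp
  qed
  also have "\<dots> \<le> (\<Sum>v\<in>L. label v 0)"
  proof (rule sum_mono2)
    show "finite L" using L(1) finite_subset by blast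
    show "{r, a, b} \<subseteq> L" using r ab by auto
    fix v assume "v \<in> L - {r, a, b}"
    then have "v \<in> set xs" using L(1) by auto
    then show "0 \<le> label v 0" using low[of v] block_le[of v] k_nonneg by simp
  qed
  finally have three: "label r 0 + label a 0 + label b 0 \<le> (\<Sum>v\<in>L. label v 0)" .
  have "3 * k + 3 * M + 2 * B + 3 \<le> (\<Sum>v\<in>L. label v 0)"
  proof -
    have "r \<in> set xs" "a \<in> set xs" "b \<in> set xs" "a \<notin> set rs" "b \<notin> set rs" using r ab L(1) by auto
    then show ?thesis using low[of r] high[of a] high[of b] three by linarith
  qed
  moreover have "leg_sum u i \<le> 2 * k + 3 * M + 2 * B"
    using u
  proof (cases rule: leg_sum_cases)
    case top
    then have "odd (n u)" using parity_cases[of u] by auto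
    then have "block u + int (half u) \<le> B" using block_odd u by blast
    moreover have "0 < int (half u)" using half_pos[OF u(1)] by simp
    ultimately show ?thesis using odds_le[OF u(1)] NB top by linarith
  next
    case leaf
    then show ?thesis using block_le[OF u(1)] B0 BM k_nonneg by linarith
  next
    case (inner t)
    then show ?thesis using block_le[OF u(1)] B0 BM k_nonneg by linarith
  qed
  ultimately show ?thesis using k_nonneg by linarith
qed

end


section \<open>Choosing the order of the legs\<close>

lemma weight_before_cong:
  "(\<And>u. u \<in> set xs \<Longrightarrow> f u = g u) \<Longrightarrow> weight_before f xs v = weight_before g xs v"
  by (induction xs) auto

text \<open>Positions break the ties of \<open>w\<close>. The constant weight 1 is the parity of an
  odd leg, so this orders the center sums at reserved odd legs.\<close>

lemma sorted_wrt_weight_before: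
  fixes w :: "'a \<Rightarrow> int"
  assumes "distinct os" "sorted (map w os)"
  shows "sorted_wrt (\<lambda>a b. w a + x + int (weight_before (\<lambda>_. 1) os a) <
    w b + x + int (weight_before (\<lambda>_. 1) os b)) os"
  using assms
proof (induction os arbitrary: x)
  case (Cons a os)
  have "sorted_wrt (\<lambda>b c. w b + x + int (weight_before (\<lambda>_. 1) (a # os) b) <
    w c + x + int (weight_before (\<lambda>_. 1) (a # os) c)) os"
    by (rule sorted_wrt_mono_rel[OF _ Cons.IH[of "x + 1"]]) (use Cons.prems in auto)
  then show ?case using Cons.prems by fastforce
qed simp

lemma sorted_listing:
  fixes w :: "'a \<Rightarrow> int"
  assumes "finite A"
  obtains xs where "set xs = A" "distinct xs" "sorted (map w xs)"
proof -
  obtain ys where "set ys = A" "distinct ys" using finite_distinct_list[OF assms] by blast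
  then show thesis using that[of "sort_key w ys"] by simp
qed

text \<open>The construction freed of the graph: \<open>I\<close> stands for the set of legs and
  \<open>c\<close> for the map to their centers.\<close>

lemma leg_order_exists:
  fixes n :: "'a \<Rightarrow> nat" and c :: "'a \<Rightarrow> 'c" and k :: int
  assumes fin: "finite I" and n2: "\<And>v. v \<in> I \<Longrightarrow> 2 \<le> n v"
    and deg: "\<And>v. v \<in> I \<Longrightarrow> 3 \<le> card {u \<in> I. c u = c v}" and k: "0 \<le> k"
  obtains xs where "leg_order k n xs" "set xs = I"
    "inj_on (\<lambda>z. \<Sum>v | v \<in> I \<and> c v = z. leg_order.label k n xs v 0) (c ` I)"
    "\<forall>z\<in>c ` I. \<forall>u\<in>I. \<forall>i<n u.
      leg_order.leg_sum k n xs u i < (\<Sum>v | v \<in> I \<and> c v = z. leg_order.label k n xs v 0)"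
proof -
  define \<rho> where "\<rho> z = (SOME v. v \<in> I \<and> c v = z)" for z
  have \<rho>: "\<rho> z \<in> I \<and> c (\<rho> z) = z" if "z \<in> c ` I" for z
    unfolding \<rho>_def by (rule someI_ex) (use that in auto)
  \<comment> \<open>\<open>q\<close> and \<open>p\<close> anticipate \<open>half\<close> and
    \<open>parity\<close>, which become available only once the list is fixed.\<close>
  define q where "q v = n v div 2" for v
  define p where "p v = n v mod 2" for v
  define Rv where "Rv = \<rho> ` c ` I"
  have RvI: "Rv \<subseteq> I" using \<rho> by (auto simp: Rv_def)
  obtain no where no: "set no = {v \<in> I - Rv. odd (n v)}" "distinct no"
    using finite_distinct_list[of "{v \<in> I - Rv. odd (n v)}"] fin by auto
  obtain ne where ne: "set ne = {v \<in> I - Rv. even (n v)}" "distinct ne"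
    using finite_distinct_list[of "{v \<in> I - Rv. even (n v)}"] fin by auto
  \<comment> \<open>\<open>T v\<close> is the future first label of a nonreserved leg. The reserved
    legs enter only through their total weights, so \<open>T\<close> and \<open>w\<close> are known
    before those legs are ordered.\<close>
  define T where "T v =
    (if odd (n v) then k + 2 * int (sum q I) + int (sum p Rv + weight_before p no v) + 1
     else k + int (sum q I) + int (sum q Rv + sum q (set no) + weight_before q ne v) + 1)" for v
  define w where "w v = (\<Sum>u\<in>{u \<in> I. c u = c v} - {v}. T u)" for v
  obtain es where es: "set es = {v \<in> Rv. even (n v)}" "distinct es" "sorted (map w es)"
    by (rule sorted_listing[of "{v \<in> Rv. even (n v)}" w]) (use fin in \<open>auto simp: Rv_def\<close>)
  obtain os where os: "set os = {v \<in> Rv. odd (n v)}" "distinct os" "sorted (map w os)"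
    by (rule sorted_listing[of "{v \<in> Rv. odd (n v)}" w]) (use fin in \<open>auto simp: Rv_def\<close>)
  \<comment> \<open>The future center sum at a reserved odd leg: reserved even legs have parity 0,
    so only the position in \<open>os\<close> counts.\<close>
  define s where "s v = w v + (k + 2 * int (sum q I) + 1) + int (weight_before (\<lambda>_. 1) os v)" for v
  have s_sorted: "sorted_wrt (\<lambda>a b. s a < s b) os"
    unfolding s_def using sorted_wrt_weight_before[OF os(2,3)] .
  \<comment> \<open>The constant \<open>k + int (sum q I) + 1\<close> is the least big label, so the
    expressions kept off the values of \<open>s\<close> are the center sums at reserved even
    legs.\<close>
  have "\<exists>rs. distinct rs \<and> set rs = set es \<union> set os \<and>
     (\<forall>v\<in>set es. w v + (k + int (sum q I) + 1) + int (weight_before q rs v) \<notin> s ` set os) \<and>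
     inj_on (\<lambda>v. w v + (k + int (sum q I) + 1) + int (weight_before q rs v)) (set es) \<and>
     (\<forall>v\<in>set os. weight_before p rs v = weight_before p os v)"
  proof (rule merge_avoiding[OF es(3) s_sorted es(2) os(2)])
    show "set es \<inter> set os = {}" using es os by auto
    show "0 < q v" if "v \<in> set es \<union> set os" for v
    proof -
      have "v \<in> I" using that es os RvI by auto
      then show ?thesis using n2[of v] by (simp add: q_def)
    qed
    show "p v = 0" if "v \<in> set es" for v using that es(1) by (simp add: p_def)
  qed
  then obtain rs where rs: "distinct rs" "set rs = set es \<union> set os"
     "\<forall>v\<in>set es. w v + (k + int (sum q I) + 1) + int (weight_before q rs v) \<notin> s ` set os"
     "inj_on (\<lambda>v. w v + (k + int (sum q I) + 1) + int (weight_before q rs v)) (set es)"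
     "\<forall>v\<in>set os. weight_before p rs v = weight_before p os v"
    by blast
  have rsR: "set rs = Rv" using rs(2) es os by auto
  define xs where "xs = rs @ no @ ne"
  have xsI: "set xs = I" using rsR no ne RvI by (auto simp: xs_def)
  have dist: "distinct xs" using rs no ne rsR by (auto simp: xs_def)
  interpret leg_order k n xs
    by unfold_locales (use k dist n2 xsI in auto)
  have hq: "half = q" and pp: "parity = p"
    by (auto simp: half_def parity_def q_def p_def)
  have M: "M = int (sum q I)"
    unfolding M_def hq by (simp add: sum_list_distinct_conv_sum_set[OF dist] xsI)
  \<comment> \<open>All of \<open>rs\<close> precedes \<open>no\<close> and \<open>ne\<close>, so
    the inner order of \<open>rs\<close> does not affect these labels.\<close>
  have label_T: "label v 0 = T v" if v: "v \<in> I" "v \<notin> Rv" for v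
  proof (cases "odd (n v)")
    case True
    then have "p v = 1" by (simp add: p_def odd_iff_mod_2_eq_one)
    moreover have "weight_before p xs v = sum p Rv + weight_before p no v"
      using True v no rsR by (simp add: xs_def weight_before_append
          sum_list_distinct_conv_sum_set[OF rs(1)])
    ultimately show ?thesis using True by (simp add: label_def pp T_def M)
  next
    case False
    then have "p v = 0" by (simp add: p_def)
    moreover have "weight_before q xs v = sum q Rv + sum q (set no) + weight_before q ne v"
      using False v no rsR by (simp add: xs_def weight_before_append
          sum_list_distinct_conv_sum_set[OF rs(1)] sum_list_distinct_conv_sum_set[OF no(2)])
    ultimately show ?thesis using False by (simp add: label_def pp hq T_def M)
  qed
  have center: "(\<Sum>v | v \<in> I \<and> c v = z. label v 0) = label (\<rho> z) 0 + w (\<rho> z)" if z: "z \<in> c ` I" for z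
  proof -
    have "label u 0 = T u" if "u \<in> {u \<in> I. c u = z} - {\<rho> z}" for u
    proof (rule label_T)
      show "u \<notin> Rv"
        using that \<rho> by (auto simp: Rv_def)
    qed (use that in auto)
    then have "w (\<rho> z) = (\<Sum>u\<in>{u \<in> I. c u = z} - {\<rho> z}. label u 0)"
      unfolding w_def using \<rho>[OF z] by simp
    then show ?thesis using \<rho>[OF z] fin
      by (subst sum.remove[of _ "\<rho> z"]) auto
  qed
  have even_label: "label v 0 = k + int (sum q I) + 1 + int (weight_before q rs v)"
    if "v \<in> set es" for v
  proof -
    have "p v = 0" using that es by (simp add: p_def)
    moreover have "weight_before q xs v = weight_before q rs v"
      using that rs(2) by (simp add: xs_def weight_before_append)
    ultimately show ?thesis by (simp add: label_def pp hq M)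
  qed
  have odd_label: "label v 0 + w v = s v" if "v \<in> set os" for v
  proof -
    have "p v = 1" using that os by (simp add: p_def odd_iff_mod_2_eq_one)
    moreover have "weight_before p os v = weight_before (\<lambda>_. 1) os v"
      by (rule weight_before_cong) (use os in \<open>simp add: p_def odd_iff_mod_2_eq_one\<close>)
    moreover have "weight_before p xs v = weight_before p os v"
      using that rs(2,5) by (simp add: xs_def weight_before_append)
    ultimately show ?thesis
      by (simp add: label_def pp M s_def)
  qed
  have s_inj: "inj_on s (set os)"
  proof -
    have "sorted_wrt (<) (map s os)" using s_sorted by (simp add: sorted_wrt_map)
    then have "distinct (map s os)" using strict_sorted_iff by blast
    then show ?thesis by (simp add: distinct_map)
  qed
  have reserved: "\<rho> z \<in> set es \<or> \<rho> z \<in> set os" if "z \<in> c ` I" for z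
    using that es os by (auto simp: Rv_def)
  have "inj_on (\<lambda>z. \<Sum>v | v \<in> I \<and> c v = z. label v 0) (c ` I)"
  proof (rule inj_onI)
    fix y z assume yz: "y \<in> c ` I" "z \<in> c ` I"
      and "(\<Sum>v | v \<in> I \<and> c v = y. label v 0) = (\<Sum>v | v \<in> I \<and> c v = z. label v 0)"
    then have eq: "label (\<rho> y) 0 + w (\<rho> y) = label (\<rho> z) 0 + w (\<rho> z)" using center by simp
    have ev: "label v 0 + w v = w v + (k + int (sum q I) + 1) + int (weight_before q rs v)"
      if "v \<in> set es" for v using even_label[OF that] by simp
    \<comment> \<open>Two even reserved legs are separated by the injectivity from the merge, two
      odd ones by the strict order of \<open>s\<close>, and a mixed pair by the avoidance of
      \<open>s\<close>.\<close>
    have "\<rho> y = \<rho> z"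
      using reserved[OF yz(1)] reserved[OF yz(2)]
    proof (elim disjE)
      assume a: "\<rho> y \<in> set es" "\<rho> z \<in> set es"
      show ?thesis using inj_onD[OF rs(4) _ a] eq ev[OF a(1)] ev[OF a(2)] by simp
    next
      assume a: "\<rho> y \<in> set os" "\<rho> z \<in> set os"
      show ?thesis using inj_onD[OF s_inj _ a] eq odd_label[OF a(1)] odd_label[OF a(2)] by simp
    next
      assume a: "\<rho> y \<in> set es" "\<rho> z \<in> set os"
      then show ?thesis using rs(3) eq ev[OF a(1)] odd_label[OF a(2)] by (metis image_eqI)
    next
      assume a: "\<rho> y \<in> set os" "\<rho> z \<in> set es"
      then show ?thesis using rs(3) eq ev[OF a(2)] odd_label[OF a(1)] by (metis image_eqI)
    qed
    then show "y = z" using \<rho> yz by metis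
  qed
  moreover have "leg_sum u i < (\<Sum>v | v \<in> I \<and> c v = z. label v 0)"
    if z: "z \<in> c ` I" and u: "u \<in> I" "i < n u" for z u i
  proof (rule leg_sum_less_center_sum[OF xs_def])
    show "even (n v)" if "v \<in> set ne" for v using that ne by simp
    show "odd (n v)" if "v \<in> set no" for v using that no by simp
    show "{v. v \<in> I \<and> c v = z} \<subseteq> set xs" using xsI by auto
    show "{v. v \<in> I \<and> c v = z} \<inter> set rs \<noteq> {}" using \<rho>[OF z] z by (auto simp: rsR Rv_def)
    have "{v. v \<in> I \<and> c v = z} - set rs = {v \<in> I. c v = z} - {\<rho> z}"
      using \<rho> z by (auto simp: rsR Rv_def)
    moreover have "3 \<le> card {v \<in> I. c v = z}" using deg[of "\<rho> z"] \<rho>[OF z] by simp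
    ultimately show "2 \<le> card ({v. v \<in> I \<and> c v = z} - set rs)"
      using \<rho>[OF z] by (simp add: card_Diff_singleton)
  qed (use u xsI in auto)
  ultimately show thesis using that leg_order_axioms xsI by blast
qed

section \<open>Legs of a spider forest\<close>

lemma is_path_singleton: "v \<in> V \<Longrightarrow> is_path V E [v]"
  by (simp add: is_path_def)

lemma is_path_prefix: "is_path V E (p @ q) \<Longrightarrow> p \<noteq> [] \<Longrightarrow> is_path V E p"
  by (auto simp: is_path_def successively_append_iff)

lemma is_path_suffix: "is_path V E (p @ q) \<Longrightarrow> q \<noteq> [] \<Longrightarrow> is_path V E q"
  by (auto simp: is_path_def successively_append_iff)

lemma is_path_rev: "is_path V E p \<Longrightarrow> is_path V E (rev p)"
  by (auto simp: is_path_def successively_rev insert_commute)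

lemma joined_by_path_sym: "joined_by_path V E u v \<Longrightarrow> joined_by_path V E v u"
  unfolding joined_by_path_def using is_path_rev by (metis hd_rev last_rev)

lemma successively_closed:
  assumes "successively R p" "p \<noteq> []" "hd p \<in> S" "\<And>x y. x \<in> S \<Longrightarrow> R x y \<Longrightarrow> y \<in> S"
  shows "set p \<subseteq> S"
  using assms(1-3)
proof (induction p)
  case (Cons a p)
  then show ?case using assms(4) by (cases p) auto
qed simp

lemma joined_by_path_step:
  assumes "finite_simple_graph V E" "joined_by_path V E v u" "{u, w} \<in> E"
  shows "joined_by_path V E v w"
proof -
  obtain p where p: "is_path V E p" "hd p = v" "last p = u"
    using assms(2) by (auto simp: joined_by_path_def)
  show ?thesis
  \<comment> \<open>Paths have distinct vertices, so a path that already visits \<open>w\<close> is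
    cut off there instead of being extended.\<close>
  proof (cases "w \<in> set p")
    case True
    then obtain as bs where "p = as @ w # bs" by (auto simp: in_set_conv_decomp)
    then have "p = (as @ [w]) @ bs" by simp
    then have "is_path V E (as @ [w])" "hd (as @ [w]) = v"
      using p is_path_prefix[of V E "as @ [w]" bs] by (auto simp: hd_append)
    then show ?thesis unfolding joined_by_path_def by (metis last_snoc)
  next
    case False
    moreover have "w \<in> V" using assms(1,3) by (auto simp: finite_simple_graph_def)
    ultimately have "is_path V E (p @ [w])" "hd (p @ [w]) = v"
      using p assms(3) by (auto simp: is_path_def successively_append_iff)
    then show ?thesis unfolding joined_by_path_def by (metis last_snoc)
  qed
qed

text \<open>Applied to components: degrees and centers, and paths starting in \<open>C\<close>, are
  then the same in the induced subgraph as in the whole graph.\<close>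

locale adjacency_closed =
  fixes V :: "'a set" and E :: "'a set set" and C :: "'a set"
  assumes graph: "finite_simple_graph V E" and sub: "C \<subseteq> V"
    and closed: "\<And>u w. u \<in> C \<Longrightarrow> {u, w} \<in> E \<Longrightarrow> w \<in> C"
begin

lemma induced_edge_iff: "u \<in> C \<Longrightarrow> {u, w} \<in> induced_edges E C \<longleftrightarrow> {u, w} \<in> E"
  using closed by (auto simp: induced_edges_def)

lemma vertex_degree_induced:
  assumes "u \<in> C"
  shows "vertex_degree (induced_edges E C) u = vertex_degree E u"
proof -
  have "e \<subseteq> C" if "e \<in> E" "u \<in> e" for e
  proof -
    obtain a b where "e = {a, b}"
      using graph \<open>e \<in> E\<close> by (auto simp: finite_simple_graph_def card_2_iff)
    then obtain w where "e = {u, w}" using \<open>u \<in> e\<close> by blast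
    then show ?thesis using closed assms that by auto
  qed
  then have "incident_edges (induced_edges E C) u = incident_edges E u"
    by (auto simp: incident_edges_def induced_edges_def)
  then show ?thesis by (simp add: vertex_degree_def)
qed

lemma is_spider_center_induced:
  "is_spider_center C (induced_edges E C) u \<longleftrightarrow> u \<in> C \<and> is_spider_center V E u"
  using sub by (auto simp: is_spider_center_def vertex_degree_induced)

lemma is_path_induced:
  assumes "is_path V E p" "hd p \<in> C"
  shows "is_path C (induced_edges E C) p"
proof -
  have sC: "set p \<subseteq> C"
    by (rule successively_closed[of "\<lambda>u v. {u, v} \<in> E"]) (use assms closed in \<open>auto simp: is_path_def\<close>)
  have "successively (\<lambda>u v. {u, v} \<in> induced_edges E C) p"
    by (rule successively_mono[of "\<lambda>u v. {u, v} \<in> E"])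
      (use assms sC induced_edge_iff in \<open>auto simp: is_path_def\<close>)
  then show ?thesis using assms sC by (simp add: is_path_def)
qed

end

text \<open>What is used of a spider forest without 1-legs, stated for the whole graph so that the
  components can be forgotten.\<close>

locale legged_graph =
  fixes V :: "'a set" and E :: "'a set set"
  assumes graph: "finite_simple_graph V E"
    and acyclic: "\<not> is_cycle V E p"
    and center_exists: "v \<in> V \<Longrightarrow> \<exists>c. is_spider_center V E c \<and> joined_by_path V E c v"
    and center_unique: "is_spider_center V E c \<Longrightarrow> is_spider_center V E d \<Longrightarrow>
      joined_by_path V E c d \<Longrightarrow> c = d"
    and long_legs: "is_leg V E p \<Longrightarrow> 2 \<le> path_edge_length p"

text \<open>Components are closed under adjacency, so a cycle, a second center joined to the first,
  or a short leg would already occur within one component.\<close>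

lemma spider_forest_legged_graph:
  assumes forest: "is_spider_forest V E"
    and long: "\<forall>C \<in> component_vertex_sets V E.
           \<forall>p. is_leg C (induced_edges E C) p \<longrightarrow> 2 \<le> path_edge_length p"
  shows "legged_graph V E"
proof -
  define comp where "comp v = {u \<in> V. joined_by_path V E v u}" for v
  have graph: "finite_simple_graph V E" using forest by (simp add: is_spider_forest_def)
  have comp_in: "comp v \<in> component_vertex_sets V E" if "v \<in> V" for v
    using that by (auto simp: comp_def component_vertex_sets_def)
  have spider: "is_spider (comp v) (induced_edges E (comp v))" if "v \<in> V" for v
    using forest comp_in[OF that] by (simp add: is_spider_forest_def)
  have self: "v \<in> comp v" if "v \<in> V" for v
    using that is_path_singleton[OF that, of E] by (force simp: comp_def joined_by_path_def)
  have closed: "adjacency_closed V E (comp v)" for v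
  proof
    show "w \<in> comp v" if "u \<in> comp v" "{u, w} \<in> E" for u w
      using that joined_by_path_step[OF graph, of v u w] graph
      by (auto simp: comp_def finite_simple_graph_def)
  qed (use graph in \<open>auto simp: comp_def\<close>)
  have hd_in: "hd p \<in> V" if "is_path V E p" for p
    using that by (auto simp: is_path_def)
  show ?thesis
  proof
    fix p
    show "\<not> is_cycle V E p"
    proof
      assume cyc: "is_cycle V E p"
      then have p: "is_path V E p" by (simp add: is_cycle_def)
      interpret adjacency_closed V E "comp (hd p)" by (rule closed)
      have h: "hd p \<in> comp (hd p)" using self hd_in[OF p] by blast
      have "is_cycle (comp (hd p)) (induced_edges E (comp (hd p))) p"
        using cyc is_path_induced[OF p h] induced_edge_iff[OF h, of "last p"]
        by (simp add: is_cycle_def insert_commute)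
      then show False using spider[OF hd_in[OF p]] by (auto simp: is_spider_def is_tree_def)
    qed
  next
    fix v assume v: "v \<in> V"
    interpret adjacency_closed V E "comp v" by (rule closed)
    obtain c where "is_spider_center (comp v) (induced_edges E (comp v)) c"
      using spider[OF v] by (auto simp: is_spider_def)
    then have "is_spider_center V E c" "c \<in> comp v"
      by (auto simp: is_spider_center_induced)
    then show "\<exists>c. is_spider_center V E c \<and> joined_by_path V E c v"
      by (auto simp: comp_def intro: joined_by_path_sym)
  next
    fix c d assume c: "is_spider_center V E c" and d: "is_spider_center V E d"
      and cd: "joined_by_path V E c d"
    interpret adjacency_closed V E "comp c" by (rule closed)
    have "c \<in> V" "d \<in> V" using c d by (auto simp: is_spider_center_def)
    then have "c \<in> comp c" "d \<in> comp c" using self cd by (auto simp: comp_def)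
    then have "is_spider_center (comp c) (induced_edges E (comp c)) c"
      "is_spider_center (comp c) (induced_edges E (comp c)) d"
      using c d by (simp_all add: is_spider_center_induced)
    then show "c = d" using spider[OF \<open>c \<in> V\<close>] by (auto simp: is_spider_def)
  next
    fix p assume leg: "is_leg V E p"
    then have p: "is_path V E p" by (simp add: is_leg_def)
    interpret adjacency_closed V E "comp (hd p)" by (rule closed)
    have h: "hd p \<in> comp (hd p)" using self hd_in[OF p] by blast
    have path: "is_path (comp (hd p)) (induced_edges E (comp (hd p))) p"
      by (rule is_path_induced[OF p h])
    then have "last p \<in> comp (hd p)" by (auto simp: is_path_def)
    then have "is_leg (comp (hd p)) (induced_edges E (comp (hd p))) p"
      using leg path h by (simp add: is_leg_def is_spider_center_induced vertex_degree_induced)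
    then show "2 \<le> path_edge_length p" using long comp_in[OF hd_in[OF p]] by blast
  qed (rule graph)
qed

section \<open>Decomposition of the graph into legs\<close>

context legged_graph
begin

definition neighbours :: "'a \<Rightarrow> 'a set" where "neighbours v = {w. {v, w} \<in> E}"

lemma edgeD: "{u, w} \<in> E \<Longrightarrow> u \<in> V \<and> w \<in> V \<and> u \<noteq> w"
  using graph by (auto simp: finite_simple_graph_def)

lemma neighbours_sym: "u \<in> neighbours w \<Longrightarrow> w \<in> neighbours u"
  by (simp add: neighbours_def insert_commute)

lemma finite_neighbours: "finite (neighbours v)"
proof -
  have "neighbours v \<subseteq> V" using edgeD by (auto simp: neighbours_def)
  then show ?thesis using graph finite_subset by (auto simp: finite_simple_graph_def)
qed

lemma incident_edges_eq: "incident_edges E v = (\<lambda>w. {v, w}) ` neighbours v"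
proof -
  have "\<exists>w. e = {v, w}" if "e \<in> E" "v \<in> e" for e
  proof -
    obtain a b where "e = {a, b}"
      using graph \<open>e \<in> E\<close> by (auto simp: finite_simple_graph_def card_2_iff)
    then show ?thesis using \<open>v \<in> e\<close> by blast
  qed
  then show ?thesis by (auto simp: incident_edges_def neighbours_def)
qed

lemma vertex_degree_eq: "vertex_degree E v = card (neighbours v)"
  unfolding vertex_degree_def incident_edges_eq
  by (rule card_image) (auto simp: inj_on_def doubleton_eq_iff)

abbreviation center :: "'a \<Rightarrow> bool" where "center \<equiv> is_spider_center V E"

lemma center_on_path:
  assumes "is_path V E (c # p)" "center c" "x \<in> set p"
  shows "\<not> center x"
proof
  assume x: "center x"
  obtain as bs where p: "c # p = (c # as @ [x]) @ bs"
    using assms(3) by (auto simp: in_set_conv_decomp)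
  have "is_path V E (c # as @ [x])"
    using is_path_prefix[of V E "c # as @ [x]" bs] assms(1) unfolding p by blast
  then have "joined_by_path V E c x"
    unfolding joined_by_path_def by (intro exI[of _ "c # as @ [x]"]) simp
  then have "c = x" using center_unique assms(2) x by blast
  then show False using assms(1,3) by (auto simp: is_path_def)
qed

text \<open>A longest path from \<open>c\<close> through \<open>v\<close> ends in a leaf: another neighbour of its last vertex would
  extend the path or close a cycle.\<close>

lemma leg_exists:
  assumes c: "center c" and v: "v \<in> neighbours c"
  shows "\<exists>p. is_leg V E (c # v # p)"
proof -
  let ?P = "\<lambda>p. is_path V E (c # v # p)"
  have start: "?P []" using v edgeD by (auto simp: is_path_def neighbours_def)
  have bound: "length p \<le> card V" if "?P p" for p
  proof -
    have "length p \<le> length (c # v # p)" by simp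
    also have "\<dots> = card (set (c # v # p))"
      using that distinct_card[of "c # v # p"] by (simp add: is_path_def)
    also have "\<dots> \<le> card V"
      using that graph by (intro card_mono) (auto simp: is_path_def finite_simple_graph_def)
    finally show ?thesis .
  qed
  have "\<exists>p. ?P p \<and> (\<forall>p'. ?P p' \<longrightarrow> length p' \<le> length p)"
    by (rule ex_has_greatest_nat[where k = "[]" and b = "card V + 1"])
      (use start bound in \<open>auto simp: less_Suc_eq_le\<close>)
  then obtain p where p: "?P p" and max: "\<And>p'. ?P p' \<Longrightarrow> length p' \<le> length p"
    by (elim exE conjE) simp
  obtain as y z where dec: "c # v # p = as @ [y, z]"
  proof (rule that)
    have "butlast (c # v # p) \<noteq> []" by simp
    then show "c # v # p =
        butlast (butlast (c # v # p)) @ [last (butlast (c # v # p)), last (c # v # p)]"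
      using append_butlast_last_id[of "butlast (c # v # p)"]
        append_butlast_last_id[of "c # v # p"] by (metis append.assoc append_Cons append_Nil list.discI)
  qed
  have yz: "{y, z} \<in> E" using p unfolding dec is_path_def by (auto simp: successively_append_iff)
  have nb: "x = y" if x: "x \<in> neighbours z" for x
  proof (rule ccontr)
    assume "x \<noteq> y"
    have zx: "{z, x} \<in> E" using x by (simp add: neighbours_def)
    show False
    proof (cases "x \<in> set (c # v # p)")
      case False
      have "is_path V E ((c # v # p) @ [x])"
        using p zx False edgeD[OF zx] unfolding dec is_path_def
        by (auto simp: successively_append_iff)
      then show False using max[of "p @ [x]"] by simp
    next
      case True
      then have "x \<in> set as" using \<open>x \<noteq> y\<close> edgeD[OF zx] unfolding dec by auto
      then obtain bs cs where as: "as = bs @ x # cs" by (auto simp: in_set_conv_decomp)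
      have "is_path V E (x # cs @ [y, z])"
        using is_path_suffix[of V E bs] p unfolding dec as by simp
      then have "is_cycle V E (x # cs @ [y, z])" using zx by (simp add: is_cycle_def)
      then show False using acyclic by blast
    qed
  qed
  have "y \<in> neighbours z" using yz by (simp add: neighbours_def insert_commute)
  then have "neighbours z = {y}" using nb by blast
  then have "vertex_degree E (last (c # v # p)) = 1"
    unfolding dec by (simp add: vertex_degree_eq)
  then have "is_leg V E (c # v # p)" using p c by (simp add: is_leg_def)
  then show ?thesis by blast
qed

text \<open>A leg is identified by its vertex adjacent to the center; the list \<open>leg v\<close> omits the center.\<close>

definition starts :: "'a set" where "starts = {v. \<exists>c. center c \<and> v \<in> neighbours c}"

definition center_of :: "'a \<Rightarrow> 'a" where "center_of v = (SOME c. center c \<and> v \<in> neighbours c)"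

definition leg :: "'a \<Rightarrow> 'a list" where
  "leg v = v # (SOME p. is_leg V E (center_of v # v # p))"

text \<open>Prepending the center shifts the indices by one, so the first entry is the inner end of
  edge \<open>j\<close> and the second its outer end.\<close>

definition leg_edge :: "'a \<Rightarrow> nat \<Rightarrow> 'a set" where
  "leg_edge v j = {(center_of v # leg v) ! j, leg v ! j}"

lemma leg_nth_0 [simp]: "leg v ! 0 = v"
  by (simp add: leg_def)

lemma
  assumes "v \<in> starts"
  shows center_center_of: "center (center_of v)"
    and neighbours_center_of: "v \<in> neighbours (center_of v)"
    and is_leg_leg: "is_leg V E (center_of v # leg v)"
proof -
  have 1: "center (center_of v) \<and> v \<in> neighbours (center_of v)"
    unfolding center_of_def by (rule someI_ex) (use assms in \<open>auto simp: starts_def\<close>)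
  then show "center (center_of v)" "v \<in> neighbours (center_of v)" by auto
  show "is_leg V E (center_of v # leg v)"
    unfolding leg_def by (rule someI_ex[OF leg_exists]) (use 1 in auto)
qed

lemma finite_starts: "finite starts"
proof -
  have "starts \<subseteq> V" using edgeD by (auto simp: starts_def neighbours_def)
  then show ?thesis using graph finite_subset by (auto simp: finite_simple_graph_def)
qed

lemma length_leg: "v \<in> starts \<Longrightarrow> 2 \<le> length (leg v)"
  using long_legs[OF is_leg_leg] by (simp add: path_edge_length_def)

lemma leg_not_center: "v \<in> starts \<Longrightarrow> x \<in> set (leg v) \<Longrightarrow> \<not> center x"
  using center_on_path[of "center_of v" "leg v" x] is_leg_leg[of v] by (auto simp: is_leg_def)

lemma leg_edge_in:
  assumes "v \<in> starts" "j < length (leg v)"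
  shows "leg_edge v j \<in> E"
proof -
  have "successively (\<lambda>u v. {u, v} \<in> E) (center_of v # leg v)"
    using is_leg_leg[OF assms(1)] by (simp add: is_leg_def is_path_def)
  then show ?thesis
    using assms(2) by (auto simp: leg_edge_def successively_conv_nth)
qed

lemma distinct_leg: "v \<in> starts \<Longrightarrow> distinct (center_of v # leg v)"
  using is_leg_leg[of v] by (simp add: is_leg_def is_path_def)

text \<open>A vertex of a leg is no center, hence has degree at most two, and its neighbours along
  the leg exhaust its neighbours; the last vertex is a leaf.\<close>

lemma neighbours_leg:
  assumes v: "v \<in> starts" and j: "j < length (leg v)"
  shows "neighbours (leg v ! j) =
    {(center_of v # leg v) ! j} \<union> (if Suc j < length (leg v) then {leg v ! Suc j} else {})"
proof -
  let ?x = "leg v ! j"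
  have pred: "(center_of v # leg v) ! j \<in> neighbours ?x"
    using leg_edge_in[OF v j] by (simp add: neighbours_def leg_edge_def insert_commute)
  have deg: "card (neighbours ?x) \<le> 2"
  proof -
    have "?x \<in> V" using is_leg_leg[OF v] j by (auto simp: is_leg_def is_path_def)
    then show ?thesis using leg_not_center[OF v, of ?x] j
      by (simp add: is_spider_center_def vertex_degree_eq)
  qed
  show ?thesis
  proof (cases "Suc j < length (leg v)")
    case True
    have succ: "leg v ! Suc j \<in> neighbours ?x"
      using leg_edge_in[OF v True] by (simp add: neighbours_def leg_edge_def)
    have "(center_of v # leg v) ! j \<noteq> (center_of v # leg v) ! (Suc (Suc j))"
      using distinct_leg[OF v] True by (subst nth_eq_iff_index_eq) auto
    then have "card {(center_of v # leg v) ! j, leg v ! Suc j} = 2" by simp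
    then have "{(center_of v # leg v) ! j, leg v ! Suc j} = neighbours ?x"
      using pred succ deg by (intro card_seteq finite_neighbours) auto
    then show ?thesis using True by auto
  next
    case False
    then have "j = length (leg v) - 1" "leg v \<noteq> []" using j by auto
    then have "?x = last (center_of v # leg v)" by (simp add: last_conv_nth)
    then have "card (neighbours ?x) = 1"
      using is_leg_leg[OF v] by (simp add: is_leg_def vertex_degree_eq)
    then show ?thesis using pred False by (auto simp: card_1_singleton_iff)
  qed
qed

lemma neighbours_leg_subset:
  assumes "v \<in> starts" "x \<in> set (leg v)"
  shows "neighbours x \<subseteq> set (center_of v # leg v)"
proof -
  obtain j where "j < length (leg v)" "x = leg v ! j" using assms(2) by (auto simp: in_set_conv_nth)
  moreover have "(center_of v # leg v) ! j \<in> set (center_of v # leg v)"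
    by (rule nth_mem) (use \<open>j < _\<close> in simp)
  ultimately show ?thesis using neighbours_leg[OF assms(1)] by auto
qed

text \<open>Walking inwards from \<open>x\<close> along \<open>leg u\<close> cannot leave
  \<open>leg v\<close>, because its only exit is a center. So \<open>u\<close> lies on
  \<open>leg v\<close>, where only the first vertex is adjacent to a center.\<close>

lemma legs_disjoint:
  assumes v: "v \<in> starts" and u: "u \<in> starts" and "x \<in> set (leg v)" "x \<in> set (leg u)"
  shows "u = v"
proof -
  have start_in: "u \<in> set (leg v)" if "j < length (leg u)" "leg u ! j \<in> set (leg v)" for j
    using that
  proof (induction j)
    case (Suc j)
    have "leg u ! j \<in> neighbours (leg u ! Suc j)"
      using neighbours_leg[OF u Suc.prems(1)] by simp
    then have "leg u ! j \<in> set (center_of v # leg v)"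
      using neighbours_leg_subset[OF v Suc.prems(2)] by blast
    moreover have "leg u ! j \<noteq> center_of v"
      using leg_not_center[OF u, of "leg u ! j"] center_center_of[OF v] Suc.prems(1) by auto
    ultimately show ?case using Suc by simp
  qed simp
  obtain j where "j < length (leg u)" "x = leg u ! j"
    using assms(4) by (auto simp: in_set_conv_nth)
  then have "u \<in> set (leg v)" using start_in assms(3) by blast
  then obtain i where i: "i < length (leg v)" "u = leg v ! i" by (auto simp: in_set_conv_nth)
  have "i = 0"
  proof (rule ccontr)
    assume "i \<noteq> 0"
    then have "neighbours u \<subseteq> set (leg v)"
      using neighbours_leg[OF v i(1)] i by auto
    then show False
      using neighbours_sym[OF neighbours_center_of[OF u]] leg_not_center[OF v] center_center_of[OF u]
      by blast
  qed
  then show "u = v" using i by simp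
qed

lemma leg_nth_inj:
  assumes "v \<in> starts" "i < length (leg v)" "u \<in> starts" "j < length (leg u)" "leg v ! i = leg u ! j"
  shows "v = u \<and> i = j"
proof -
  have "u = v" using legs_disjoint[OF assms(1,3)] assms(2,4,5) nth_mem by metis
  then show ?thesis
    using assms distinct_leg[OF assms(1)] by (simp add: nth_eq_iff_index_eq)
qed

text \<open>Every vertex is joined to a center, and the set on the right contains the centers and is
  closed under adjacency.\<close>

lemma vertices_subset: "V \<subseteq> Collect center \<union> (\<Union>v\<in>starts. set (leg v))" (is "V \<subseteq> ?S")
proof
  fix x assume "x \<in> V"
  then obtain c p where c: "center c" and p: "is_path V E p" "hd p = c" "last p = x"
    using center_exists[of x] by (auto simp: joined_by_path_def)
  have step: "y \<in> ?S" if "x \<in> ?S" "y \<in> neighbours x" for x y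
    using that(1)
  proof
    assume "x \<in> Collect center"
    then have "y \<in> starts" "y \<in> set (leg y)" using that(2) by (auto simp: starts_def leg_def)
    then show ?thesis by blast
  next
    assume "x \<in> (\<Union>v\<in>starts. set (leg v))"
    then obtain v where v: "v \<in> starts" "x \<in> set (leg v)" by blast
    then show ?thesis using neighbours_leg_subset[OF v] that(2) center_center_of[OF v(1)] by auto
  qed
  have "set p \<subseteq> ?S"
    by (rule successively_closed[of "\<lambda>u v. {u, v} \<in> E"])
      (use p c step in \<open>auto simp: is_path_def neighbours_def\<close>)
  moreover have "x \<in> set p" using p by (auto simp: is_path_def)
  ultimately show "x \<in> ?S" by blast
qed

lemma vertex_cases:
  assumes "x \<in> V"
  obtains (center) "center x"
  | (leg) v j where "v \<in> starts" "j < length (leg v)" "x = leg v ! j"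
  using subsetD[OF vertices_subset assms] by (auto simp: in_set_conv_nth)

lemma neighbours_center:
  assumes "center c"
  shows "neighbours c = {v \<in> starts. center_of v = c}"
proof
  show "{v \<in> starts. center_of v = c} \<subseteq> neighbours c" using neighbours_center_of by auto
  show "neighbours c \<subseteq> {v \<in> starts. center_of v = c}"
  proof
    fix v assume v: "v \<in> neighbours c"
    then have s: "v \<in> starts" using assms by (auto simp: starts_def)
    \<comment> \<open>\<open>c\<close> is a neighbour of \<open>v\<close>, so it lies on this path;
      being a center, it can only be the start.\<close>
    have "c \<in> set (center_of v # leg v)"
      using neighbours_leg_subset[OF s, of v] neighbours_sym[OF v] by (auto simp: leg_def)
    then show "v \<in> {v \<in> starts. center_of v = c}" using leg_not_center[OF s] assms s by auto
  qed
qed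

lemma incident_edges_leg:
  assumes "v \<in> starts" "j < length (leg v)"
  shows "incident_edges E (leg v ! j) =
    {leg_edge v j} \<union> (if Suc j < length (leg v) then {leg_edge v (Suc j)} else {})"
  unfolding incident_edges_eq neighbours_leg[OF assms]
  by (auto simp: leg_edge_def)

lemma incident_edges_center:
  assumes "center c"
  shows "incident_edges E c = (\<lambda>v. leg_edge v 0) ` {v \<in> starts. center_of v = c}"
  unfolding incident_edges_eq neighbours_center[OF assms]
  by (auto simp: leg_edge_def image_iff)

text \<open>Outer ends determine leg and index, so two representations of one edge would traverse it
  in opposite directions, forcing both \<open>i = j - 1\<close> and
  \<open>j = i - 1\<close>.\<close>

lemma leg_edge_inj:
  assumes v: "v \<in> starts" "i < length (leg v)" and u: "u \<in> starts" "j < length (leg u)"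
    and eq: "leg_edge v i = leg_edge u j"
  shows "v = u \<and> i = j"
proof (rule ccontr)
  assume ne: "\<not> ?thesis"
  then have 1: "leg v ! i = (center_of u # leg u) ! j" "leg u ! j = (center_of v # leg v) ! i"
    using eq leg_nth_inj[OF v u] by (auto simp: leg_edge_def doubleton_eq_iff)
  \<comment> \<open>For \<open>j = 0\<close> the inner end is a center, which is never an outer
    end.\<close>
  have "j \<noteq> 0"
    using 1(1) leg_not_center[OF v(1) nth_mem[OF v(2)]] center_center_of[OF u(1)]
    by (cases j) auto
  moreover have "i \<noteq> 0"
    using 1(2) leg_not_center[OF u(1) nth_mem[OF u(2)]] center_center_of[OF v(1)]
    by (cases i) auto
  ultimately have "leg v ! i = leg u ! (j - 1)" "leg v ! (i - 1) = leg u ! j"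
    using 1 by (auto simp: nth_Cons')
  then have "i = j - 1" "i - 1 = j"
    using leg_nth_inj[OF v u(1), of "j - 1"] leg_nth_inj[OF v(1) _ u, of "i - 1"] v u by auto
  then show False using \<open>i \<noteq> 0\<close> by simp
qed

lemma edge_cases:
  assumes e: "e \<in> E"
  obtains v j where "v \<in> starts" "j < length (leg v)" "e = leg_edge v j"
proof -
  obtain x where x: "x \<in> e" "x \<in> V"
    using graph e by (fastforce simp: finite_simple_graph_def card_2_iff)
  then have inc: "e \<in> incident_edges E x" using e by (simp add: incident_edges_def)
  show thesis
    using x(2)
  proof (cases rule: vertex_cases)
    case center
    then obtain v where v: "v \<in> starts" "e = leg_edge v 0"
      using inc incident_edges_center by auto
    moreover have "0 < length (leg v)" using length_leg[OF v(1)] by linarith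
    ultimately show thesis using that by blast
  next
    case (leg v j)
    then have "e = leg_edge v j \<or> Suc j < length (leg v) \<and> e = leg_edge v (Suc j)"
      using inc incident_edges_leg[OF leg(1,2)] by (auto split: if_splits)
    then show thesis using that leg(1,2) by blast
  qed
qed

lemma edges_eq: "(\<lambda>(v, j). leg_edge v j) ` (SIGMA v:starts. {..<length (leg v)}) = E"
  using leg_edge_in by (auto elim!: edge_cases)

section \<open>The labeling of the graph\<close>

lemma shifted_antimagic_nonneg:
  assumes "0 \<le> k"
  shows "shifted_antimagic k V E"
proof -
  let ?n = "\<lambda>v. length (leg v)"
  let ?A = "SIGMA v:starts. {..<?n v}"
  have deg: "3 \<le> card {u \<in> starts. center_of u = center_of v}" if "v \<in> starts" for v
    using center_center_of[OF that] neighbours_center[OF center_center_of[OF that]]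
    by (simp add: is_spider_center_def vertex_degree_eq)
  have centers: "c \<in> center_of ` starts" if "center c" for c
  proof -
    have "neighbours c \<noteq> {}" using that by (auto simp: is_spider_center_def vertex_degree_eq)
    then show ?thesis using neighbours_center[OF that] by auto
  qed
  obtain xs where order: "leg_order k ?n xs" and xs: "set xs = starts"
    and inj: "inj_on (\<lambda>z. \<Sum>v | v \<in> starts \<and> center_of v = z. leg_order.label k ?n xs v 0)
      (center_of ` starts)"
    and less: "\<forall>z\<in>center_of ` starts. \<forall>u\<in>starts. \<forall>i<?n u.
      leg_order.leg_sum k ?n xs u i <
        (\<Sum>v | v \<in> starts \<and> center_of v = z. leg_order.label k ?n xs v 0)"
    by (rule leg_order_exists[OF finite_starts length_leg deg assms])
  interpret leg_order k ?n xs by (rule order)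
  let ?center_sum = "\<lambda>z. \<Sum>v | v \<in> starts \<and> center_of v = z. label v 0"
  \<comment> \<open>As \<open>leg_edge\<close> is injective on \<open>?A\<close>, the preimage is
    unique and \<open>f\<close> carries \<open>label\<close> over to the edges.\<close>
  define f where "f e = (case inv_into ?A (\<lambda>(v, j). leg_edge v j) e of (v, j) \<Rightarrow> label v j)" for e
  have edge_inj: "inj_on (\<lambda>(v, j). leg_edge v j) ?A"
    using leg_edge_inj by (auto simp: inj_on_def)
  have f_edge: "f (leg_edge v j) = label v j" if "v \<in> starts" "j < ?n v" for v j
    using inv_into_f_f[OF edge_inj, of "(v, j)"] that by (simp add: f_def)
  have card_E: "card E = (\<Sum>v\<in>starts. ?n v)"
    using card_image[OF edge_inj] finite_starts by (simp add: edges_eq)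
  have "bij_betw f E {k + 1..k + int (card E)}"
  proof -
    have "inj_on f E"
    proof (rule inj_onI)
      fix d e assume d: "d \<in> E" and e: "e \<in> E" and eq: "f d = f e"
      obtain v i where v: "v \<in> starts" "i < ?n v" "d = leg_edge v i" by (rule edge_cases[OF d])
      obtain u j where u: "u \<in> starts" "j < ?n u" "e = leg_edge u j" by (rule edge_cases[OF e])
      show "d = e" using eq label_inj[of v i u j] f_edge v u by (simp add: xs)
    qed
    \<comment> \<open>Inclusion suffices: the interval has \<open>card E\<close> elements, so the
      injective \<open>f\<close> is onto.\<close>
    moreover have "f ` E \<subseteq> {k + 1..k + int (card E)}"
    proof
      fix y assume "y \<in> f ` E"
      then obtain v j where "v \<in> starts" "j < ?n v" "y = f (leg_edge v j)"
        by (auto elim!: edge_cases)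
      then show "y \<in> {k + 1..k + int (card E)}"
        using label_range[of v j] f_edge by (simp add: xs card_E)
    qed
    moreover have "card {k + 1..k + int (card E)} = card E" by simp
    ultimately show ?thesis
      by (metis bij_betw_def card_image card_subset_eq finite_atLeastAtMost_int)
  qed
  moreover have leg_vertex: "vertex_sum E f (leg v ! j) = leg_sum v j"
    if v: "v \<in> starts" "j < ?n v" for v j
  proof (cases "Suc j < ?n v")
    case True
    \<comment> \<open>Distinctness keeps both labels as separate terms of the sum over the set of
      incident edges.\<close>
    have "leg_edge v j \<noteq> leg_edge v (Suc j)"
      using leg_edge_inj[OF v v(1) True] by auto
    then show ?thesis
      using True v by (simp add: vertex_sum_def incident_edges_leg f_edge leg_sum_def)
  next
    case False
    then show ?thesis using v by (simp add: vertex_sum_def incident_edges_leg f_edge leg_sum_def)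
  qed
  have center_vertex: "vertex_sum E f c = ?center_sum c" if c: "center c" for c
  proof -
    have pos: "0 < ?n v" if "v \<in> starts" for v using length_leg[OF that] by linarith
    have "inj_on (\<lambda>v. leg_edge v 0) {v \<in> starts. center_of v = c}"
      using leg_edge_inj[OF _ pos _ pos] by (intro inj_onI) blast
    then show ?thesis
      unfolding vertex_sum_def incident_edges_center[OF c]
      using f_edge pos by (subst sum.reindex) (auto intro!: sum.cong)
  qed
  have "vertex_sum E f x \<noteq> vertex_sum E f y" if xy: "x \<in> V" "y \<in> V" "x \<noteq> y" for x y
    using xy(1)
  proof (cases rule: vertex_cases)
    case x: center
    show ?thesis
      using xy(2)
    proof (cases rule: vertex_cases)
      case center
      then show ?thesis
        using inj_onD[OF inj _ centers[OF x] centers[OF center]] xy(3)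
        by (auto simp: center_vertex x)
    next
      case (leg v j)
      then have "leg_sum v j < ?center_sum x" using less centers[OF x] by blast
      then have "vertex_sum E f y < vertex_sum E f x"
        using leg_vertex[OF leg(1,2)] center_vertex[OF x] leg(3) by simp
      then show ?thesis by simp
    qed
  next
    case x: (leg u i)
    show ?thesis
      using xy(2)
    proof (cases rule: vertex_cases)
      case center
      then have "leg_sum u i < ?center_sum y" using less centers x(1,2) by blast
      then have "vertex_sum E f x < vertex_sum E f y"
        using leg_vertex[OF x(1,2)] center_vertex[OF center] x(3) by simp
      then show ?thesis by simp
    next
      case (leg v j)
      then show ?thesis
        using leg_sum_inj[of u i v j] x xy(3) by (auto simp: xs leg_vertex)
    qed
  qed
  ultimately show ?thesis
    unfolding shifted_antimagic_def shifted_antimagic_labeling_def by blast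
qed

end

theorem theorem1:
  fixes V :: "'a set" and E :: "'a set set"
  assumes "is_spider_forest V E"
    and "\<forall>C \<in> component_vertex_sets V E.
           \<forall>p. is_leg C (induced_edges E C) p \<longrightarrow> 2 \<le> path_edge_length p"
  shows "\<forall>k::int. 0 \<le> k \<longrightarrow> shifted_antimagic k V E"
  using legged_graph.shifted_antimagic_nonneg[OF spider_forest_legged_graph[OF assms]] by blast

end
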